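(* Consider polynomials in $n$ variables and of degree $2d$, let $N={n+d \choose d}$, and let $\alpha = \{k_1, \ldots, k_g\}$, $\beta = \{l_1, \ldots, l_h\}$ and $\gamma = \{N_1,N_2\}$ be three partitions of $N$, i.e. $\sum_{i=1}^g k_i = \sum_{i=1}^h l_i =N_1 + N_2 = N$, with $\alpha \sqsubseteq \beta$ ($\alpha$ is a sub-partition of $\beta$). Let $\mathbf{1}=\{1,\ldots,1\}$ be the trivial partition of $N$. Then $$ \mathit{SDSOS}_{n,2d} = \mathbf{1}\text{-}\mathit{SDSOS}_{n,2d} \subseteq \alpha\text{-}\mathit{SDSOS}_{n,2d} \subseteq \beta\text{-}\mathit{SDSOS}_{n,2d} \subseteq \gamma\text{-}\mathit{SDSOS}_{n,2d} = \mathit{SOS}_{n, 2d}. $$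
   Context: A partition of $N$ is an ordered list $\alpha=\{k_1,\ldots,k_g\}$ of positive integers with $\sum_{i=1}^g k_i=N$; throughout, every partition has at least two blocks. Sub-partition: given partitions $\{a_1,\ldots,a_s\}$ and $\{b_1,\ldots,b_t\}$ of $N$ with $s<t$, we write $\{b_1,\ldots,b_t\}\sqsubseteq\{a_1,\ldots,a_s\}$ if there are integers $1=m_1<m_2<\cdots<m_{s+1}=t+1$ with $a_i=\sum_{j=m_i}^{m_{i+1}-1} b_j$ for all $i=1,\ldots,s$. Let $E_i^\alpha\in\mathbb{R}^{k_i\times N}$ be the $i$-th block row of $I_N$ when the rows of $I_N$ are split consecutively into blocks of sizes $k_1,\ldots,k_g$, and for $i\neq j$ let $E_{ij}^\alpha=\begin{bmatrix}(E_i^\alpha)^{\mathsf T} & (E_j^\alpha)^{\mathsf T}\end{bmatrix}^{\mathsf T}$. Let $v_d(x) = [ 1,x_1,\ldots,x_n,x_1^2,x_1x_2,\ldots,x_n^d ]^{\mathsf T}$ be the vector of all $N$ monomials in $x\in\mathbb{R}^n$ of degree at most $d$. Polynomials are real and "degree $2d$" is understood as degree at most $2d$. $\mathit{SOS}_{n,2d}$ is the set of polynomials in $n$ variables of degree $2d$ that are finite sums of squares of polynomials. $\alpha\text{-}\mathit{SDSOS}_{n,2d}$ is the set of polynomials of the form $$p(x) = \sum_{1 \leq i < j \leq g}\left(\sum_{t=1}^{k_i + k_j} \left(f_{ij,t}^{\mathsf T} m_{ij}(x)\right)^2\right),\qquad f_{ij,t}\in\mathbb{R}^{k_i+k_j},\quad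 m_{ij}(x)=E_{ij}^\alpha v_d(x).$$ $\mathit{SDSOS}_{n,2d}$ (scaled diagonally dominant sum-of-squares polynomials) is the set of polynomials $p(x)=v_d(x)^{\mathsf T}Q\,v_d(x)$ with $Q\in\mathcal{FW}_2^N$, where $\mathcal{FW}_2^N$ is the set of $N\times N$ matrices $VV^{\mathsf T}$ with $V$ a real matrix each of whose columns has at most $2$ nonzero entries (equivalently, $Q$ is symmetric scaled diagonally dominant). *)

theory Defs
  imports
    "HOL-Library.Poly_Mapping"
    "Jordan_Normal_Form.Matrix"
begin

text \<open>
  Real multivariate polynomials are finitely supported maps from monomials to coefficients, with
  the convolution product; a monomial maps each variable to its exponent. The variables
  \<open>x\<^sub>1, \<dots>, x\<^sub>n\<close> are numbered \<open>0, \<dots>, n - 1\<close>. Blocks of a partition, matrix rows and vector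
  entries are likewise numbered from \<open>0\<close>.
\<close>

type_synonym monomial = "nat \<Rightarrow>\<^sub>0 nat"
type_synonym rpoly = "monomial \<Rightarrow>\<^sub>0 real"

definition monomial_degree :: "monomial \<Rightarrow> nat" where
  "monomial_degree m = (\<Sum>i\<in>Poly_Mapping.keys m. Poly_Mapping.lookup m i)"

definition in_vars :: "nat \<Rightarrow> rpoly \<Rightarrow> bool" where
  "in_vars n p \<longleftrightarrow> (\<forall>m\<in>Poly_Mapping.keys p. Poly_Mapping.keys m \<subseteq> {..<n})"

definition degree_le :: "rpoly \<Rightarrow> nat \<Rightarrow> bool" where
  "degree_le p k \<longleftrightarrow> (\<forall>m\<in>Poly_Mapping.keys p. monomial_degree m \<le> k)"

definition const_poly :: "real \<Rightarrow> rpoly" where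
  "const_poly c = Poly_Mapping.single 0 c"

definition monomials_of_degree :: "nat \<Rightarrow> nat \<Rightarrow> monomial set" where
  "monomials_of_degree n k = {m. Poly_Mapping.keys m \<subseteq> {..<n} \<and> monomial_degree m = k}"

text \<open>
  The library order on monomials compares the exponents of the first variable in which they
  differ, so \<^term>\<open>rev\<close> yields \<open>x\<^sub>1\<^sup>2, x\<^sub>1x\<^sub>2, \<dots>, x\<^sub>n\<^sup>2\<close> in degree two.
\<close>

definition monomial_list :: "nat \<Rightarrow> nat \<Rightarrow> monomial list" where
  "monomial_list n d =
     concat (map (\<lambda>k. rev (sorted_list_of_set (monomials_of_degree n k))) [0..<Suc d])"

definition monomial_vec :: "nat \<Rightarrow> nat \<Rightarrow> rpoly vec" where
  "monomial_vec n d = vec_of_list (map (\<lambda>m. Poly_Mapping.single m 1) (monomial_list n d))"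

lemma bij_monomials_of_degree:
  "bij_betw (\<lambda>m. map (Poly_Mapping.lookup m) [0..<n]) (monomials_of_degree n k)
     {l. length l = n \<and> sum_list l = k}"
proof (rule bij_betwI[where g = "Poly_Mapping.nth"])
  have deg: "monomial_degree m = (\<Sum>i<n. Poly_Mapping.lookup m i)"
    if "Poly_Mapping.keys m \<subseteq> {..<n}" for m
    unfolding monomial_degree_def
    by (rule sum.mono_neutral_left) (use that in \<open>auto simp: in_keys_iff\<close>)
  show "(\<lambda>m. map (Poly_Mapping.lookup m) [0..<n]) \<in> monomials_of_degree n k \<rightarrow>
      {l. length l = n \<and> sum_list l = k}"
    using deg by (auto simp: monomials_of_degree_def sum_list_sum_nth atLeast0LessThan)
  have keys: "Poly_Mapping.keys (Poly_Mapping.nth l) \<subseteq> {..<length l}" for l :: "nat list"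
    by (auto simp: in_keys_iff nth.rep_eq nth_default_def in_set_enumerate_eq split: if_splits)
  show "Poly_Mapping.nth \<in> {l. length l = n \<and> sum_list l = k} \<rightarrow> monomials_of_degree n k"
    using deg keys by (auto simp: monomials_of_degree_def sum_list_sum_nth atLeast0LessThan
        nth.rep_eq nth_default_def in_set_enumerate_eq)
  show "Poly_Mapping.nth (map (Poly_Mapping.lookup m) [0..<n]) = m"
    if "m \<in> monomials_of_degree n k" for m
    using that by (intro poly_mapping_eqI)
      (auto simp: monomials_of_degree_def nth.rep_eq nth_default_def in_keys_iff subset_iff)
  show "map (Poly_Mapping.lookup (Poly_Mapping.nth l)) [0..<n] = l"
    if "l \<in> {l. length l = n \<and> sum_list l = k}" for l
    using that by (auto intro!: nth_equalityI simp: nth.rep_eq nth_default_def)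
qed

lemma finite_monomials_of_degree: "finite (monomials_of_degree n k)"
proof -
  have "l \<in> {l. set l \<subseteq> {..k} \<and> length l = n}" if "length l = n" "sum_list l = k" for l
    using that member_le_sum_list by fastforce
  then have "{l. length l = n \<and> sum_list l = k} \<subseteq> {l. set l \<subseteq> {..k} \<and> length l = n}"
    by blast
  then have "finite {l. length l = n \<and> sum_list l = k}"
    by (rule finite_subset) (simp add: finite_lists_length_eq)
  then show ?thesis using bij_betw_finite[OF bij_monomials_of_degree] by blast
qed

lemma card_monomials_of_degree: "card (monomials_of_degree n k) = (k + n - 1) choose k"
  using bij_betw_same_card[OF bij_monomials_of_degree[of n k]]
  by (simp only: card_length_sum_list)

lemma length_monomial_list: "length (monomial_list n d) = (n + d) choose d"
  by (induction d) (simp_all add: monomial_list_def card_monomials_of_degree add.commute)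

lemma dim_monomial_vec: "dim_vec (monomial_vec n d) = (n + d) choose d"
  by (simp add: monomial_vec_def length_monomial_list)

lemma set_monomial_list:
  "set (monomial_list n d) = {m. Poly_Mapping.keys m \<subseteq> {..<n} \<and> monomial_degree m \<le> d}"
  using finite_monomials_of_degree
  by (auto simp: monomial_list_def monomials_of_degree_def less_Suc_eq_le)

definition is_partition :: "nat \<Rightarrow> nat list \<Rightarrow> bool" where
  "is_partition N \<alpha> \<longleftrightarrow> 2 \<le> length \<alpha> \<and> (\<forall>k\<in>set \<alpha>. 0 < k) \<and> sum_list \<alpha> = N"

text \<open>The breakpoints \<open>m i\<close> below are those of the usual definition minus one.\<close>

definition subpartition :: "nat list \<Rightarrow> nat list \<Rightarrow> bool" (infix \<open>\<sqsubseteq>\<^sub>p\<close> 50) where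
  "b \<sqsubseteq>\<^sub>p a \<longleftrightarrow> length a < length b \<and>
     (\<exists>m :: nat \<Rightarrow> nat. m 0 = 0 \<and> m (length a) = length b \<and>
        (\<forall>i<length a. m i < m (Suc i)) \<and>
        (\<forall>i<length a. a ! i = (\<Sum>j = m i..<m (Suc i). b ! j)))"

definition block_row :: "nat \<Rightarrow> nat list \<Rightarrow> nat \<Rightarrow> real mat" where
  "block_row N \<alpha> i =
     mat_of_rows N (map (row (1\<^sub>m N)) [sum_list (take i \<alpha>)..<sum_list (take (Suc i) \<alpha>)])"

definition block_rows2 :: "nat \<Rightarrow> nat list \<Rightarrow> nat \<Rightarrow> nat \<Rightarrow> real mat" where
  "block_rows2 N \<alpha> i j = block_row N \<alpha> i @\<^sub>r block_row N \<alpha> j"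

definition block_monomial_vec :: "nat list \<Rightarrow> nat \<Rightarrow> nat \<Rightarrow> nat \<Rightarrow> nat \<Rightarrow> rpoly vec" where
  "block_monomial_vec \<alpha> n d i j =
     map_mat const_poly (block_rows2 ((n + d) choose d) \<alpha> i j) *\<^sub>v monomial_vec n d"

text \<open>
  The last argument \<open>d\<close> of \<open>SOS\<close>, \<open>block_SDSOS\<close> and \<open>SDSOS\<close> stands for the degree bound \<open>2d\<close>.
\<close>

definition SOS :: "nat \<Rightarrow> nat \<Rightarrow> rpoly set" where
  "SOS n d = {p. in_vars n p \<and> degree_le p (2 * d) \<and>
     (\<exists>qs. (\<forall>q\<in>set qs. in_vars n q) \<and> p = (\<Sum>q\<leftarrow>qs. q\<^sup>2))}"

definition block_SDSOS :: "nat list \<Rightarrow> nat \<Rightarrow> nat \<Rightarrow> rpoly set" where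
  "block_SDSOS \<alpha> n d = {p. \<exists>f :: nat \<Rightarrow> nat \<Rightarrow> nat \<Rightarrow> real vec.
     (\<forall>i j t. i < j \<and> j < length \<alpha> \<and> t < \<alpha> ! i + \<alpha> ! j \<longrightarrow>
        f i j t \<in> carrier_vec (\<alpha> ! i + \<alpha> ! j)) \<and>
     p = (\<Sum>(i, j)\<in>{(i, j). i < j \<and> j < length \<alpha>}.
            \<Sum>t<\<alpha> ! i + \<alpha> ! j.
              (map_vec const_poly (f i j t) \<bullet> block_monomial_vec \<alpha> n d i j)\<^sup>2)}"

definition FW2 :: "nat \<Rightarrow> real mat set" where
  "FW2 N = {V * V\<^sup>T | V. dim_row V = N \<and>
     (\<forall>c<dim_col V. card {r. r < N \<and> V $$ (r, c) \<noteq> 0} \<le> 2)}"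

definition SDSOS :: "nat \<Rightarrow> nat \<Rightarrow> rpoly set" where
  "SDSOS n d = {monomial_vec n d \<bullet> (map_mat const_poly Q *\<^sub>v monomial_vec n d) | Q.
     Q \<in> FW2 ((n + d) choose d)}"

end

theory Submission
  imports Defs
begin

text \<open>
  All the cones consist of sums of squares of polynomials whose supports are confined to one member
  of a family of monomial sets: the unions of two blocks for \<open>block_SDSOS\<close>, pairs of monomials for
  \<open>SDSOS\<close>, and all monomials of degree at most \<open>d\<close> for \<open>SOS\<close>, since leading terms of squares cannot
  cancel. The exact number of squares prescribed in \<open>block_SDSOS\<close> is immaterial, because a Cholesky
  elimination turns any sum of squares supported on \<open>K\<close> monomials into one of \<open>K\<close> squares. The
  inclusions then say that one family of supports refines another.
\<close>

section \<open>Coefficients\<close>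

lemma lookup_const_poly_mult:
  "Poly_Mapping.lookup (const_poly c * p) m = c * Poly_Mapping.lookup p m"
  unfolding const_poly_def mult_map_scale_conv_mult[symmetric]
  by (simp add: map.rep_eq when_def)

lemma const_poly_0: "const_poly 0 = 0"
  by (simp add: const_poly_def)

lemma const_poly_1: "const_poly 1 = 1"
  by (simp add: const_poly_def)

lemma const_poly_mult: "const_poly (a * b) = const_poly a * const_poly b"
  by (simp add: const_poly_def mult_single)

lemma const_poly_sum: "const_poly (sum f A) = (\<Sum>x\<in>A. const_poly (f x))"
  by (induction A rule: infinite_finite_induct) (simp_all add: const_poly_def single_add)

lemma const_poly_mult_single: "const_poly c * Poly_Mapping.single m 1 = Poly_Mapping.single m c"
  by (simp add: const_poly_def mult_single)

lemma poly_eq_sum_single: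
  fixes q :: rpoly
  assumes "finite S" "Poly_Mapping.keys q \<subseteq> S"
  shows "q = (\<Sum>m\<in>S. Poly_Mapping.single m (Poly_Mapping.lookup q m))"
proof (rule poly_mapping_eqI)
  fix k
  show "Poly_Mapping.lookup q k =
      Poly_Mapping.lookup (\<Sum>m\<in>S. Poly_Mapping.single m (Poly_Mapping.lookup q m)) k"
    using assms by (auto simp: lookup_sum lookup_single when_def in_keys_iff subset_iff)
qed

text \<open>The coefficient of \<open>m + m\<close> in the square collects all pairs of monomials of
  \<open>q\<close> with that sum; under the hypothesis only the diagonal pair is left. For a leading
  monomial this rules out cancellation.\<close>

lemma lookup_square_double:
  fixes q :: rpoly
  assumes "\<And>a b. \<lbrakk>a \<in> Poly_Mapping.keys q; b \<in> Poly_Mapping.keys q; a + b = m + m\<rbrakk> \<Longrightarrow> a = m \<and> b = m"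
  shows "Poly_Mapping.lookup (q\<^sup>2) (m + m) = (Poly_Mapping.lookup q m)\<^sup>2"
proof -
  let ?K = "Poly_Mapping.keys q" and ?c = "Poly_Mapping.lookup q"
  have "q\<^sup>2 = (\<Sum>a\<in>?K. Poly_Mapping.single a (?c a)) * (\<Sum>b\<in>?K. Poly_Mapping.single b (?c b))"
    using poly_eq_sum_single[of ?K q] by (simp add: power2_eq_square)
  also have "\<dots> = (\<Sum>a\<in>?K. \<Sum>b\<in>?K. Poly_Mapping.single (a + b) (?c a * ?c b))"
    by (simp add: sum_product mult_single)
  finally have "Poly_Mapping.lookup (q\<^sup>2) (m + m) =
      (\<Sum>a\<in>?K. \<Sum>b\<in>?K. ?c a * ?c b when a + b = m + m)"
    by (simp add: lookup_sum lookup_single)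
  also have "\<dots> = (\<Sum>a\<in>?K. \<Sum>b\<in>?K. if b = m then (if a = m then ?c a * ?c b else 0) else 0)"
  proof (intro sum.cong refl)
    fix a b assume "a \<in> ?K" "b \<in> ?K"
    then have "a + b = m + m \<longleftrightarrow> a = m \<and> b = m" using assms by blast
    then show "(?c a * ?c b when a + b = m + m) = (if b = m then (if a = m then ?c a * ?c b else 0) else 0)"
      by (simp add: when_def)
  qed
  also have "\<dots> = (?c m)\<^sup>2"
    by (cases "?c m = 0") (simp_all add: in_keys_iff power2_eq_square)
  finally show ?thesis .
qed

lemma keys_sum_subset:
  fixes f :: "'a \<Rightarrow> rpoly"
  assumes "\<And>x. x \<in> A \<Longrightarrow> Poly_Mapping.keys (f x) \<subseteq> S"
  shows "Poly_Mapping.keys (sum f A) \<subseteq> S"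
  using assms
  by (induction A rule: infinite_finite_induct) (auto dest!: keys_add[THEN subsetD])

lemma keys_const_poly_mult: "Poly_Mapping.keys (const_poly c * p) \<subseteq> Poly_Mapping.keys p"
  by (auto simp: in_keys_iff lookup_const_poly_mult)

lemma monomial_degree_add: "monomial_degree (a + b) = monomial_degree a + monomial_degree b"
proof -
  have "monomial_degree m = (\<Sum>i\<in>Poly_Mapping.keys a \<union> Poly_Mapping.keys b. Poly_Mapping.lookup m i)"
    if "Poly_Mapping.keys m \<subseteq> Poly_Mapping.keys a \<union> Poly_Mapping.keys b" for m
    unfolding monomial_degree_def
    by (rule sum.mono_neutral_left) (use that in \<open>auto simp: in_keys_iff\<close>)
  then show ?thesis using keys_add[of a b] by (simp add: lookup_add sum.distrib)
qed

section \<open>Sums of squares with prescribed supports\<close>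

text \<open>A list leaves the number and the repetition of squares free, so that membership is
  governed by supports alone and appending lists adds elements.\<close>

definition supported_sos :: "monomial set set \<Rightarrow> rpoly set" where
  "supported_sos \<S> = {\<Sum>q\<leftarrow>qs. q\<^sup>2 | qs. \<forall>q\<in>set qs. \<exists>S\<in>\<S>. Poly_Mapping.keys q \<subseteq> S}"

lemma supported_sos_mono:
  assumes "\<And>S. S \<in> \<S> \<Longrightarrow> \<exists>T\<in>\<T>. S \<subseteq> T"
  shows "supported_sos \<S> \<subseteq> supported_sos \<T>"
proof
  fix p assume "p \<in> supported_sos \<S>"
  then obtain qs where p: "p = (\<Sum>q\<leftarrow>qs. q\<^sup>2)"
    and qs: "\<forall>q\<in>set qs. \<exists>S\<in>\<S>. Poly_Mapping.keys q \<subseteq> S"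
    unfolding supported_sos_def by blast
  have "\<forall>q\<in>set qs. \<exists>T\<in>\<T>. Poly_Mapping.keys q \<subseteq> T"
    using qs assms by (meson subset_trans)
  then show "p \<in> supported_sos \<T>"
    unfolding supported_sos_def using p by blast
qed

lemma supported_sos_add:
  assumes "p \<in> supported_sos \<S>" "q \<in> supported_sos \<S>"
  shows "p + q \<in> supported_sos \<S>"
proof -
  obtain ps qs where "p = (\<Sum>r\<leftarrow>ps. r\<^sup>2)" "\<forall>r\<in>set ps. \<exists>S\<in>\<S>. Poly_Mapping.keys r \<subseteq> S"
    "q = (\<Sum>r\<leftarrow>qs. r\<^sup>2)" "\<forall>r\<in>set qs. \<exists>S\<in>\<S>. Poly_Mapping.keys r \<subseteq> S"
    using assms unfolding supported_sos_def by blast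
  then show ?thesis
    unfolding supported_sos_def by (intro CollectI exI[of _ "ps @ qs"]) auto
qed

lemma supported_sos_0: "0 \<in> supported_sos \<S>"
  unfolding supported_sos_def by (auto intro: exI[of _ "[]"])

lemma supported_sos_sum:
  "(\<And>x. x \<in> A \<Longrightarrow> f x \<in> supported_sos \<S>) \<Longrightarrow> sum f A \<in> supported_sos \<S>"
  by (induction A rule: infinite_finite_induct) (auto intro: supported_sos_add supported_sos_0)

lemma supported_sos_square:
  assumes "S \<in> \<S>" "Poly_Mapping.keys q \<subseteq> S"
  shows "q\<^sup>2 \<in> supported_sos \<S>"
proof -
  have "\<forall>q\<in>set [q]. \<exists>S\<in>\<S>. Poly_Mapping.keys q \<subseteq> S" using assms by auto
  then show ?thesis
    unfolding supported_sos_def by (intro CollectI exI[of _ "[q]"]) simp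
qed

section \<open>Bounding the number of squares by the size of the support\<close>

text \<open>
  One step of a Cholesky decomposition: if \<open>c\<^sub>t\<close> is the coefficient of \<open>m\<close> in \<open>q\<^sub>t\<close>, \<open>s = \<Sum> c\<^sub>t\<^sup>2\<close> and
  \<open>b = \<Sum> c\<^sub>t q\<^sub>t\<close>, then \<open>\<Sum> q\<^sub>t\<^sup>2 = \<Sum> (q\<^sub>t - (c\<^sub>t / s) b)\<^sup>2 + b\<^sup>2 / s\<close>, and \<open>m\<close> no longer occurs in the
  polynomials \<open>q\<^sub>t - (c\<^sub>t / s) b\<close>.
\<close>

lemma sum_squares_eliminate_monomial:
  fixes q :: "nat \<Rightarrow> rpoly"
  assumes keys: "\<And>t. t < k \<Longrightarrow> Poly_Mapping.keys (q t) \<subseteq> insert m S"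
  obtains r b where "\<And>t. t < k \<Longrightarrow> Poly_Mapping.keys (r t) \<subseteq> S"
    "Poly_Mapping.keys b \<subseteq> insert m S" "(\<Sum>t<k. (q t)\<^sup>2) = (\<Sum>t<k. (r t)\<^sup>2) + b\<^sup>2"
proof -
  define c where "c t = Poly_Mapping.lookup (q t) m" for t
  define s where "s = (\<Sum>t<k. (c t)\<^sup>2)"
  show ?thesis
  proof (cases "s = 0")
    \<comment> \<open>A vanishing sum of real squares has vanishing terms, so \<open>m\<close>
      occurs in no \<open>q t\<close> and \<open>r = q\<close>, \<open>b = 0\<close> will
      do.\<close>
    case True
    then have "c t = 0" if "t < k" for t
      using that by (simp add: s_def sum_nonneg_eq_0_iff)
    then have "Poly_Mapping.keys (q t) \<subseteq> S" if "t < k" for t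
      using keys[OF that] that by (auto simp: c_def in_keys_iff)
    then show ?thesis using that[of q 0] by simp
  next
    case False
    then have s: "s > 0" by (simp add: s_def sum_nonneg order.not_eq_order_implies_strict)
    define b where "b = (\<Sum>t<k. const_poly (c t) * q t)"
    define r where "r t = q t - const_poly (c t / s) * b" for t
    have b_keys: "Poly_Mapping.keys b \<subseteq> insert m S"
      unfolding b_def using keys keys_const_poly_mult by (intro keys_sum_subset) fastforce
    have b_m: "Poly_Mapping.lookup b m = s"
      by (simp add: b_def s_def lookup_sum lookup_const_poly_mult c_def power2_eq_square)
    have r_keys: "Poly_Mapping.keys (r t) \<subseteq> S" if "t < k" for t
    proof -
      have "Poly_Mapping.keys (r t) \<subseteq> insert m S"
        unfolding r_def using keys[OF that] b_keys keys_const_poly_mult keys_diff by fastforce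
      moreover have "m \<notin> Poly_Mapping.keys (r t)"
        using s by (simp add: r_def in_keys_iff lookup_minus lookup_const_poly_mult b_m c_def)
      ultimately show ?thesis by blast
    qed
    let ?C = const_poly
    have sq: "(r t)\<^sup>2 = (q t)\<^sup>2 - 2 * ?C (1 / s) * b * (?C (c t) * q t)
        + (?C (1 / s))\<^sup>2 * b\<^sup>2 * ?C ((c t)\<^sup>2)" for t
    proof -
      have "?C (c t / s) = ?C (1 / s) * ?C (c t)"
        by (simp add: const_poly_mult[symmetric])
      moreover have "?C ((c t)\<^sup>2) = (?C (c t))\<^sup>2"
        by (simp add: power2_eq_square const_poly_mult)
      ultimately show ?thesis
        unfolding r_def by (simp add: power2_eq_square algebra_simps)
    qed
    \<comment> \<open>The cross terms sum to \<open>-2 b\<^sup>2 / s\<close> and the last terms to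
      \<open>b\<^sup>2 / s\<close>, since the squares of the \<open>c t\<close> add up to
      \<open>s\<close>.\<close>
    have "(\<Sum>t<k. (r t)\<^sup>2) = (\<Sum>t<k. (q t)\<^sup>2) - 2 * ?C (1 / s) * b * b
        + (?C (1 / s))\<^sup>2 * b\<^sup>2 * ?C s"
      unfolding sq
      by (simp only: sum.distrib sum_subtractf sum_distrib_left[symmetric] b_def[symmetric]
          s_def const_poly_sum)
    also have "(?C (1 / s))\<^sup>2 * b\<^sup>2 * ?C s = ?C (1 / s) * b * b"
    proof -
      have "(?C (1 / s))\<^sup>2 * ?C s = ?C (1 / s)"
        using s by (simp add: power2_eq_square const_poly_mult[symmetric])
      then show ?thesis by (metis (no_types) mult.assoc mult.commute power2_eq_square)
    qed
    finally have "(\<Sum>t<k. (q t)\<^sup>2) = (\<Sum>t<k. (r t)\<^sup>2) + ?C (1 / s) * b * b"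
      by (simp add: algebra_simps)
    \<comment> \<open>As \<open>s > 0\<close>, the factor \<open>1 / s\<close> has a real root that
      moves into the square; the witness for the \<open>b\<close> of the statement is thus the local
      \<open>b\<close> divided by \<open>sqrt s\<close>.\<close>
    also have "?C (1 / s) = ?C (1 / sqrt s) * ?C (1 / sqrt s)"
      using s by (simp add: const_poly_mult[symmetric])
    finally have "(\<Sum>t<k. (q t)\<^sup>2) = (\<Sum>t<k. (r t)\<^sup>2) + (?C (1 / sqrt s) * b)\<^sup>2"
      by (simp add: power2_eq_square algebra_simps)
    then show ?thesis
      using that[of r "?C (1 / sqrt s) * b"] r_keys b_keys keys_const_poly_mult by blast
  qed
qed

text \<open>Induction on the support: eliminating one monomial from all \<open>q t\<close> costs one
  square, and once the support is exhausted the remaining polynomials are zero.\<close>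

lemma sum_squares_reduce:
  fixes q :: "nat \<Rightarrow> rpoly"
  assumes "finite S" "\<And>t. t < k \<Longrightarrow> Poly_Mapping.keys (q t) \<subseteq> S"
  shows "\<exists>r. (\<forall>t<card S. Poly_Mapping.keys (r t) \<subseteq> S) \<and> (\<Sum>t<k. (q t)\<^sup>2) = (\<Sum>t<card S. (r t)\<^sup>2)"
  using assms
proof (induction S arbitrary: q rule: finite_induct)
  case empty
  then show ?case by simp
next
  case (insert m S)
  obtain r b where r: "\<And>t. t < k \<Longrightarrow> Poly_Mapping.keys (r t) \<subseteq> S"
    "Poly_Mapping.keys b \<subseteq> insert m S" "(\<Sum>t<k. (q t)\<^sup>2) = (\<Sum>t<k. (r t)\<^sup>2) + b\<^sup>2"
    using sum_squares_eliminate_monomial insert.prems by metis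
  obtain r' where r': "\<forall>t<card S. Poly_Mapping.keys (r' t) \<subseteq> S"
    "(\<Sum>t<k. (r t)\<^sup>2) = (\<Sum>t<card S. (r' t)\<^sup>2)"
    using insert.IH[of r] r(1) by blast
  \<comment> \<open>The square split off takes the new slot \<open>card S\<close>, after the slots
    filled by the induction hypothesis.\<close>
  show ?case
    using r r' insert.hyps
    by (intro exI[of _ "r'(card S := b)"]) (auto simp: less_Suc_eq)
qed

text \<open>Each \<open>q\<close> is filed under one index whose support contains it, chosen
  arbitrarily when several do; supports may overlap, as those of block pairs with a common
  block.\<close>

lemma sum_list_squares_group:
  assumes "finite I" "\<And>q. q \<in> set qs \<Longrightarrow> \<exists>i\<in>I. Poly_Mapping.keys q \<subseteq> S i"
  shows "\<exists>h. (\<forall>i\<in>I. \<forall>q\<in>set (h i). Poly_Mapping.keys q \<subseteq> S i) \<and>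
    (\<Sum>q\<leftarrow>qs. q\<^sup>2) = (\<Sum>i\<in>I. \<Sum>q\<leftarrow>h i. (q :: rpoly)\<^sup>2)"
  using assms(2)
proof (induction qs)
  case Nil
  show ?case by (rule exI[of _ "\<lambda>_. []"]) simp
next
  case (Cons q qs)
  obtain h where h: "\<forall>i\<in>I. \<forall>q\<in>set (h i). Poly_Mapping.keys q \<subseteq> S i"
    "(\<Sum>q\<leftarrow>qs. q\<^sup>2) = (\<Sum>i\<in>I. \<Sum>q\<leftarrow>h i. q\<^sup>2)"
    using Cons by auto
  obtain j where j: "j \<in> I" "Poly_Mapping.keys q \<subseteq> S j" using Cons.prems by auto
  have "(\<Sum>i\<in>I. \<Sum>q\<leftarrow>(h(j := q # h j)) i. q\<^sup>2) = (\<Sum>i\<in>I. (if i = j then q\<^sup>2 else 0) + (\<Sum>q\<leftarrow>h i. q\<^sup>2))"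
    by (intro sum.cong) auto
  also have "\<dots> = q\<^sup>2 + (\<Sum>i\<in>I. \<Sum>q\<leftarrow>h i. q\<^sup>2)"
    using j assms(1) by (simp add: sum.distrib)
  finally show ?case
    using h j by (intro exI[of _ "h(j := q # h j)"]) auto
qed

text \<open>Grouping by index and then reducing each group gives the shape that
  \<open>block_SDSOS\<close> prescribes, where \<open>card (S i)\<close> becomes the total size of
  two blocks.\<close>

lemma supported_sos_normal_form:
  assumes "finite I" "\<And>i. i \<in> I \<Longrightarrow> finite (S i)"
    and "p \<in> supported_sos (S ` I)"
  obtains r where "\<And>i t. \<lbrakk>i \<in> I; t < card (S i)\<rbrakk> \<Longrightarrow> Poly_Mapping.keys (r i t) \<subseteq> S i"
    "p = (\<Sum>i\<in>I. \<Sum>t<card (S i). (r i t)\<^sup>2)"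
proof -
  obtain qs where qs: "p = (\<Sum>q\<leftarrow>qs. q\<^sup>2)" "\<forall>q\<in>set qs. \<exists>i\<in>I. Poly_Mapping.keys q \<subseteq> S i"
    using assms(3) by (auto simp: supported_sos_def)
  obtain h where h: "\<forall>i\<in>I. \<forall>q\<in>set (h i). Poly_Mapping.keys q \<subseteq> S i"
    "p = (\<Sum>i\<in>I. \<Sum>q\<leftarrow>h i. q\<^sup>2)"
    using sum_list_squares_group[OF assms(1)] qs by metis
  have "\<exists>r. (\<forall>t<card (S i). Poly_Mapping.keys (r t) \<subseteq> S i) \<and>
      (\<Sum>q\<leftarrow>h i. q\<^sup>2) = (\<Sum>t<card (S i). (r t)\<^sup>2)" if "i \<in> I" for i
    using sum_squares_reduce[of "S i" "length (h i)" "(!) (h i)"] assms(2) h(1) that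
    by (simp add: sum_list_sum_nth atLeast0LessThan)
  then obtain r where "\<And>i. i \<in> I \<Longrightarrow> (\<forall>t<card (S i). Poly_Mapping.keys (r i t) \<subseteq> S i) \<and>
      (\<Sum>q\<leftarrow>h i. q\<^sup>2) = (\<Sum>t<card (S i). (r i t)\<^sup>2)"
    by metis
  then show ?thesis using that[of r] h(2) by simp
qed

section \<open>The degree bound\<close>

text \<open>
  If the largest degree among the monomials of the \<open>q\<close> is \<open>D\<close> and \<open>m\<close> is the largest monomial of that
  degree, then \<open>m + m\<close> arises only as a product of \<open>m\<close> with itself, so its coefficient in \<open>\<Sum> q\<^sup>2\<close>
  is a nonvanishing sum of squares: leading terms do not cancel.
\<close>

lemma degree_le_sum_squares:
  assumes "degree_le (\<Sum>q\<leftarrow>qs. q\<^sup>2) (2 * d)" "q \<in> set qs"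
  shows "degree_le q d"
proof -
  define M where "M = (\<Union>q\<in>set qs. Poly_Mapping.keys q)"
  have fin: "finite M" by (simp add: M_def)
  have "monomial_degree m \<le> d" if "m \<in> M" for m
  proof -
    define D where "D = Max (monomial_degree ` M)"
    define T where "T = {m \<in> M. monomial_degree m = D}"
    have D: "monomial_degree a \<le> D" if "a \<in> M" for a
      using that fin by (simp add: D_def)
    have "D \<in> monomial_degree ` M"
      unfolding D_def using fin that by (intro Max_in) auto
    then have "T \<noteq> {}" "finite T" using fin by (auto simp: T_def)
    then obtain m' where "m' \<in> T" and max: "\<And>a. a \<in> T \<Longrightarrow> a \<le> m'"
      using Max_in[of T] Max_ge[of T] by blast
    then have m': "m' \<in> M" "monomial_degree m' = D" by (simp_all add: T_def)
    have only: "a = m' \<and> b = m'" if "a \<in> M" "b \<in> M" "a + b = m' + m'" for a b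
    proof -
      have "monomial_degree a + monomial_degree b = D + D"
        using that(3) m'(2) by (metis monomial_degree_add)
      \<comment> \<open>Neither degree exceeds \<open>D\<close> and they add up to
        \<open>D + D\<close>, so both equal \<open>D\<close>.\<close>
      then have "a \<in> T" "b \<in> T" using D[OF that(1)] D[OF that(2)] that by (auto simp: T_def)
      then have "a \<le> m'" "b \<le> m'" using max by auto
      \<comment> \<open>Addition is strictly monotone in the monomial order, so a strict inequality
        in either place would make \<open>a + b\<close> smaller than \<open>m' + m'\<close>.\<close>
      then show ?thesis
        using that(3) by (metis add_le_less_mono add_less_le_mono less_irrefl order_le_less)
    qed
    \<comment> \<open>Stated for lists \<open>ps\<close> drawn from \<open>qs\<close>, so that the
      induction keeps \<open>M\<close> and \<open>m'\<close> fixed.\<close>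
    have sum: "Poly_Mapping.lookup (\<Sum>q\<leftarrow>ps. q\<^sup>2) (m' + m') = (\<Sum>q\<leftarrow>ps. (Poly_Mapping.lookup q m')\<^sup>2)"
      if "set ps \<subseteq> set qs" for ps
      using that
    proof (induction ps)
      case (Cons p ps)
      have "Poly_Mapping.lookup (p\<^sup>2) (m' + m') = (Poly_Mapping.lookup p m')\<^sup>2"
      proof (rule lookup_square_double)
        have "Poly_Mapping.keys p \<subseteq> M" using Cons.prems by (auto simp: M_def)
        then show "a = m' \<and> b = m'"
          if "a \<in> Poly_Mapping.keys p" "b \<in> Poly_Mapping.keys p" "a + b = m' + m'" for a b
          using that by (intro only) auto
      qed
      then show ?case using Cons by (simp add: lookup_add)
    qed simp
    obtain p where p: "p \<in> set qs" "Poly_Mapping.lookup p m' \<noteq> 0"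
      using m'(1) by (auto simp: M_def in_keys_iff)
    have "0 < (Poly_Mapping.lookup p m')\<^sup>2" using p by simp
    also have "\<dots> \<le> (\<Sum>q\<leftarrow>qs. (Poly_Mapping.lookup q m')\<^sup>2)"
      using p by (intro member_le_sum_list) auto
    finally have "m' + m' \<in> Poly_Mapping.keys (\<Sum>q\<leftarrow>qs. q\<^sup>2)"
      using sum[of qs] by (simp add: in_keys_iff)
    then have "D + D \<le> 2 * d"
      using assms(1) m'(2) by (auto simp: degree_le_def monomial_degree_add)
    then show ?thesis using D[OF that] by simp
  qed
  then show ?thesis using assms(2) by (auto simp: degree_le_def M_def)
qed

lemma keys_sum_list_squares:
  fixes qs :: "rpoly list"
  assumes "m \<in> Poly_Mapping.keys (\<Sum>q\<leftarrow>qs. q\<^sup>2)"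
  obtains q a b where "q \<in> set qs" "a \<in> Poly_Mapping.keys q" "b \<in> Poly_Mapping.keys q" "m = a + b"
proof -
  have "\<exists>q\<in>set qs. m \<in> Poly_Mapping.keys (q\<^sup>2)"
    using assms by (induction qs) (auto dest!: keys_add[THEN subsetD])
  then show ?thesis
    using that by (auto simp: power2_eq_square dest!: keys_mult[THEN subsetD])
qed

text \<open>\<open>SOS\<close> bounds the degree of the sum only, so one direction rests on
  \<open>degree_le_sum_squares\<close>; in the other, the degrees of two factors add up to at most
  \<open>2 * d\<close>.\<close>

lemma SOS_eq_supported_sos: "SOS n d = supported_sos {set (monomial_list n d)}"
proof (intro subset_antisym subsetI)
  fix p assume "p \<in> SOS n d"
  then obtain qs where "degree_le p (2 * d)" "\<forall>q\<in>set qs. in_vars n q" "p = (\<Sum>q\<leftarrow>qs. q\<^sup>2)"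
    by (auto simp: SOS_def)
  moreover from this have "\<forall>q\<in>set qs. degree_le q d"
    using degree_le_sum_squares by blast
  ultimately show "p \<in> supported_sos {set (monomial_list n d)}"
    by (fastforce simp: supported_sos_def set_monomial_list in_vars_def degree_le_def)
next
  fix p assume "p \<in> supported_sos {set (monomial_list n d)}"
  then obtain qs where p: "p = (\<Sum>q\<leftarrow>qs. q\<^sup>2)"
    and qs: "\<And>q m. \<lbrakk>q \<in> set qs; m \<in> Poly_Mapping.keys q\<rbrakk> \<Longrightarrow> Poly_Mapping.keys m \<subseteq> {..<n} \<and> monomial_degree m \<le> d"
    unfolding supported_sos_def set_monomial_list by blast
  have "Poly_Mapping.keys m \<subseteq> {..<n} \<and> monomial_degree m \<le> 2 * d" if m: "m \<in> Poly_Mapping.keys p" for m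
  proof -
    obtain q a b where q: "q \<in> set qs" "a \<in> Poly_Mapping.keys q" "b \<in> Poly_Mapping.keys q" "m = a + b"
      by (rule keys_sum_list_squares[OF m[unfolded p]])
    then show ?thesis
      using qs[OF q(1,2)] qs[OF q(1,3)] keys_add[of a b] by (auto simp: monomial_degree_add)
  qed
  then have "in_vars n p" "degree_le p (2 * d)"
    by (auto simp: in_vars_def degree_le_def)
  moreover have "\<forall>q\<in>set qs. in_vars n q" using qs by (auto simp: in_vars_def)
  ultimately show "p \<in> SOS n d"
    unfolding SOS_def using p by blast
qed

section \<open>Blocks of monomials\<close>

lemma distinct_monomial_list: "distinct (monomial_list n d)"
proof (induction d)
  case 0
  show ?case by (simp add: monomial_list_def)
next
  case (Suc d)
  have "monomial_list n (Suc d) =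
      monomial_list n d @ rev (sorted_list_of_set (monomials_of_degree n (Suc d)))"
    by (simp add: monomial_list_def)
  then show ?case
    using Suc set_monomial_list[of n d] finite_monomials_of_degree[of n "Suc d"]
    by (auto simp: monomials_of_degree_def)
qed

definition block_indices :: "nat list \<Rightarrow> nat \<Rightarrow> nat set" where
  "block_indices \<alpha> i = {sum_list (take i \<alpha>)..<sum_list (take (Suc i) \<alpha>)}"

text \<open>The entries of \<open>m\<^sub>i\<^sub>j(x)\<close> as a set. Taking the pair as one
  argument makes this a family indexed by \<open>block_pairs\<close>, the form used in
  \<open>supported_sos_normal_form\<close>.\<close>

definition pair_monomials :: "nat list \<Rightarrow> nat \<Rightarrow> nat \<Rightarrow> nat \<times> nat \<Rightarrow> monomial set" where
  "pair_monomials \<alpha> n d = (\<lambda>(i, j). (!) (monomial_list n d) ` (block_indices \<alpha> i \<union> block_indices \<alpha> j))"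

definition block_pairs :: "nat list \<Rightarrow> (nat \<times> nat) set" where
  "block_pairs \<alpha> = {(i, j). i < j \<and> j < length \<alpha>}"

lemma finite_block_pairs: "finite (block_pairs \<alpha>)"
  by (rule finite_subset[of _ "{..<length \<alpha>} \<times> {..<length \<alpha>}"]) (auto simp: block_pairs_def)

lemma sum_list_take_Suc:
  fixes \<alpha> :: "nat list"
  shows "i < length \<alpha> \<Longrightarrow> sum_list (take (Suc i) \<alpha>) = sum_list (take i \<alpha>) + \<alpha> ! i"
  by (simp add: take_Suc_conv_app_nth)

lemma sum_list_take_mono:
  fixes \<alpha> :: "nat list"
  assumes "i \<le> j"
  shows "sum_list (take i \<alpha>) \<le> sum_list (take j \<alpha>)"
  using take_add[of i "j - i" \<alpha>] assms by simp

lemma sum_list_take_le: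
  fixes \<alpha> :: "nat list"
  shows "sum_list (take i \<alpha>) \<le> sum_list \<alpha>"
  using append_take_drop_id[of i \<alpha>] by (metis le_add1 sum_list_append)

lemma block_indices_subset: "block_indices \<alpha> i \<subseteq> {..<sum_list \<alpha>}"
  using sum_list_take_le[of "Suc i" \<alpha>] by (auto simp: block_indices_def)

text \<open>Serves both for the partial sums of block sizes and for the breakpoints of a
  subpartition.\<close>

lemma ex_step_interval:
  fixes f :: "nat \<Rightarrow> nat"
  assumes "f 0 \<le> r" "r < f k"
  shows "\<exists>i<k. f i \<le> r \<and> r < f (Suc i)"
  using assms(2)
proof (induction k)
  case 0
  then show ?case using assms(1) by simp
next
  case (Suc k)
  show ?case
  proof (cases "r < f k")
    case True
    then show ?thesis using Suc.IH less_SucI by blast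
  next
    case False
    then show ?thesis using Suc.prems by (intro exI[of _ k]) simp
  qed
qed

lemma ex_block_index:
  assumes "r < sum_list \<alpha>"
  shows "\<exists>i<length \<alpha>. r \<in> block_indices \<alpha> i"
  using ex_step_interval[of "\<lambda>i. sum_list (take i \<alpha>)" r "length \<alpha>"] assms
  by (simp add: block_indices_def)

section \<open>The vectors \<open>m\<^sub>i\<^sub>j(x)\<close> in coordinates\<close>

text \<open>The position in the monomial list of the entry \<open>t\<close> of \<open>m\<^sub>i\<^sub>j(x)\<close>.\<close>

definition pair_index :: "nat list \<Rightarrow> nat \<times> nat \<Rightarrow> nat \<Rightarrow> nat" where
  "pair_index \<alpha> = (\<lambda>(i, j) t.
     if t < \<alpha> ! i then sum_list (take i \<alpha>) + t else sum_list (take j \<alpha>) + (t - \<alpha> ! i))"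

text \<open>As \<open>i < j\<close>, block \<open>i\<close> ends before block \<open>j\<close>
  begins, so the blocks are disjoint and the inverse map tells them apart by one comparison with the
  end of block \<open>i\<close>.\<close>

lemma bij_betw_pair_index:
  assumes "i < j" "j < length \<alpha>"
  shows "bij_betw (pair_index \<alpha> (i, j)) {..<\<alpha> ! i + \<alpha> ! j} (block_indices \<alpha> i \<union> block_indices \<alpha> j)"
proof -
  have le: "sum_list (take i \<alpha>) + \<alpha> ! i \<le> sum_list (take j \<alpha>)"
    using assms sum_list_take_mono[of "Suc i" j \<alpha>] by (simp add: sum_list_take_Suc)
  show ?thesis
    by (rule bij_betwI[where g = "\<lambda>r. if r < sum_list (take (Suc i) \<alpha>) then r - sum_list (take i \<alpha>)
          else r - sum_list (take j \<alpha>) + \<alpha> ! i"])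
      (use assms le in \<open>auto simp: pair_index_def block_indices_def sum_list_take_Suc\<close>)
qed

text \<open>The listed monomials are distinct, so positions can be traded for monomials. This gives
  the size of the support and lets sums over entries be reindexed.\<close>

lemma bij_betw_pair_monomials:
  assumes "sum_list \<alpha> = (n + d) choose d" "(i, j) \<in> block_pairs \<alpha>"
  shows "bij_betw (\<lambda>t. monomial_list n d ! pair_index \<alpha> (i, j) t) {..<\<alpha> ! i + \<alpha> ! j}
     (pair_monomials \<alpha> n d (i, j))"
proof -
  let ?I = "block_indices \<alpha> i \<union> block_indices \<alpha> j"
  have "?I \<subseteq> {..<length (monomial_list n d)}"
    using block_indices_subset[of \<alpha>] assms(1) by (auto simp: length_monomial_list)
  then have "bij_betw ((!) (monomial_list n d)) ?I (pair_monomials \<alpha> n d (i, j))"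
    using inj_on_nth[OF distinct_monomial_list, of ?I n d]
    by (auto simp: bij_betw_def pair_monomials_def)
  moreover have "bij_betw (pair_index \<alpha> (i, j)) {..<\<alpha> ! i + \<alpha> ! j} ?I"
    using assms(2) by (intro bij_betw_pair_index) (auto simp: block_pairs_def)
  ultimately have "bij_betw ((!) (monomial_list n d) \<circ> pair_index \<alpha> (i, j)) {..<\<alpha> ! i + \<alpha> ! j}
      (pair_monomials \<alpha> n d (i, j))"
    by (rule bij_betw_trans[rotated])
  then show ?thesis by (simp add: comp_def)
qed

lemma block_row_dims:
  assumes "i < length \<alpha>"
  shows "dim_row (block_row N \<alpha> i) = \<alpha> ! i" "dim_col (block_row N \<alpha> i) = N"
  using assms by (simp_all add: block_row_def take_Suc_conv_app_nth)

lemma block_row_index: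
  assumes "sum_list \<alpha> = N" "i < length \<alpha>" "t < \<alpha> ! i" "r < N"
  shows "block_row N \<alpha> i $$ (t, r) = (if r = sum_list (take i \<alpha>) + t then 1 else 0)"
proof -
  have "sum_list (take i \<alpha>) + t < N"
    using assms sum_list_take_le[of "Suc i" \<alpha>] by (simp add: sum_list_take_Suc)
  then show ?thesis
    using assms by (auto simp: block_row_def sum_list_take_Suc mat_of_rows_index simp del: upt_Suc)
qed

lemma monomial_vec_index:
  "r < (n + d) choose d \<Longrightarrow> monomial_vec n d $ r = Poly_Mapping.single (monomial_list n d ! r) 1"
  by (simp add: monomial_vec_def vec_of_list_index length_monomial_list)

lemma block_monomial_vec_dim:
  assumes "(i, j) \<in> block_pairs \<alpha>"
  shows "dim_vec (block_monomial_vec \<alpha> n d i j) = \<alpha> ! i + \<alpha> ! j"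
  using assms
  by (simp add: block_monomial_vec_def block_rows2_def append_rows_def block_row_dims block_pairs_def)

text \<open>Row \<open>t\<close> of \<open>E\<^sub>i\<^sub>j\<close> is a unit row vector, so the
  matrix product selects a single monomial.\<close>

lemma block_monomial_vec_index:
  assumes \<alpha>: "sum_list \<alpha> = (n + d) choose d" and ij: "(i, j) \<in> block_pairs \<alpha>"
    and t: "t < \<alpha> ! i + \<alpha> ! j"
  shows "block_monomial_vec \<alpha> n d i j $ t =
     Poly_Mapping.single (monomial_list n d ! pair_index \<alpha> (i, j) t) 1"
proof -
  let ?N = "(n + d) choose d" and ?E = "block_rows2 ((n + d) choose d) \<alpha> i j"
  let ?k = "pair_index \<alpha> (i, j) t"
  have ij': "i < length \<alpha>" "j < length \<alpha>" using ij by (auto simp: block_pairs_def)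
  have dims: "dim_row ?E = \<alpha> ! i + \<alpha> ! j" "dim_col ?E = ?N"
    using ij' by (simp_all add: block_rows2_def append_rows_def block_row_dims)
  have "?k \<in> block_indices \<alpha> i \<union> block_indices \<alpha> j"
    using bij_betw_pair_index[of i j \<alpha>] ij t by (auto simp: block_pairs_def bij_betw_def)
  then have k: "?k < ?N" using block_indices_subset[of \<alpha>] \<alpha> by auto
  have E: "?E $$ (t, r) = (if r = ?k then 1 else 0)" if "r < ?N" for r
    using that t ij' block_row_index[OF \<alpha>]
    by (auto simp: block_rows2_def append_rows_def block_row_dims pair_index_def)
  have "block_monomial_vec \<alpha> n d i j $ t = (\<Sum>r<?N. const_poly (?E $$ (t, r)) * monomial_vec n d $ r)"
    using t dims
    by (simp add: block_monomial_vec_def scalar_prod_def dim_monomial_vec atLeast0LessThan)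
  also have "\<dots> = (\<Sum>r<?N. if r = ?k then monomial_vec n d $ r else 0)"
    by (intro sum.cong refl) (simp add: E const_poly_0 const_poly_1)
  also have "\<dots> = monomial_vec n d $ ?k" using k by simp
  finally show ?thesis using k by (simp add: monomial_vec_index)
qed

lemma scalar_prod_block_monomial_vec:
  assumes "sum_list \<alpha> = (n + d) choose d" "(i, j) \<in> block_pairs \<alpha>"
    and "f \<in> carrier_vec (\<alpha> ! i + \<alpha> ! j)"
  shows "map_vec const_poly f \<bullet> block_monomial_vec \<alpha> n d i j =
     (\<Sum>t<\<alpha> ! i + \<alpha> ! j. Poly_Mapping.single (monomial_list n d ! pair_index \<alpha> (i, j) t) (f $ t))"
  using assms
  by (simp add: scalar_prod_def block_monomial_vec_dim block_monomial_vec_index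
      const_poly_mult_single atLeast0LessThan)

text \<open>From left to right, each scalar product is supported on its two blocks; conversely, the
  normal form supplies squares in the required number.\<close>

lemma block_SDSOS_eq_supported_sos:
  assumes \<alpha>: "sum_list \<alpha> = (n + d) choose d"
  shows "block_SDSOS \<alpha> n d = supported_sos (pair_monomials \<alpha> n d ` block_pairs \<alpha>)"
proof (intro subset_antisym subsetI)
  fix p assume "p \<in> block_SDSOS \<alpha> n d"
  then obtain f :: "nat \<Rightarrow> nat \<Rightarrow> nat \<Rightarrow> real vec" where
    f: "\<And>i j t. i < j \<and> j < length \<alpha> \<and> t < \<alpha> ! i + \<alpha> ! j \<Longrightarrow> f i j t \<in> carrier_vec (\<alpha> ! i + \<alpha> ! j)"
    and p: "p = (\<Sum>(i, j)\<in>block_pairs \<alpha>. \<Sum>t<\<alpha> ! i + \<alpha> ! j.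
              (map_vec const_poly (f i j t) \<bullet> block_monomial_vec \<alpha> n d i j)\<^sup>2)"
    unfolding block_SDSOS_def block_pairs_def by blast
  have "(map_vec const_poly (f i j t) \<bullet> block_monomial_vec \<alpha> n d i j)\<^sup>2
      \<in> supported_sos (pair_monomials \<alpha> n d ` block_pairs \<alpha>)"
    if ij: "(i, j) \<in> block_pairs \<alpha>" and t: "t < \<alpha> ! i + \<alpha> ! j" for i j t
  proof (rule supported_sos_square)
    show "pair_monomials \<alpha> n d (i, j) \<in> pair_monomials \<alpha> n d ` block_pairs \<alpha>"
      using ij by blast
    have "f i j t \<in> carrier_vec (\<alpha> ! i + \<alpha> ! j)"
      using f ij t by (auto simp: block_pairs_def)
    then show "Poly_Mapping.keys (map_vec const_poly (f i j t) \<bullet> block_monomial_vec \<alpha> n d i j)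
        \<subseteq> pair_monomials \<alpha> n d (i, j)"
      using bij_betw_apply[OF bij_betw_pair_monomials[OF \<alpha> ij]]
      by (subst scalar_prod_block_monomial_vec[OF \<alpha> ij])
        (auto intro!: keys_sum_subset split: if_splits)
  qed
  then show "p \<in> supported_sos (pair_monomials \<alpha> n d ` block_pairs \<alpha>)"
    unfolding p by (intro supported_sos_sum) (auto intro!: supported_sos_sum)
next
  fix p assume p: "p \<in> supported_sos (pair_monomials \<alpha> n d ` block_pairs \<alpha>)"
  have card: "card (pair_monomials \<alpha> n d (i, j)) = \<alpha> ! i + \<alpha> ! j"
    if "(i, j) \<in> block_pairs \<alpha>" for i j
    using bij_betw_same_card[OF bij_betw_pair_monomials[OF \<alpha> that]] by simp
  have fin: "finite (pair_monomials \<alpha> n d x)" for x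
    by (simp add: pair_monomials_def block_indices_def split: prod.split)
  obtain r where
    r: "\<And>x t. \<lbrakk>x \<in> block_pairs \<alpha>; t < card (pair_monomials \<alpha> n d x)\<rbrakk> \<Longrightarrow>
          Poly_Mapping.keys (r x t) \<subseteq> pair_monomials \<alpha> n d x"
    and p_r: "p = (\<Sum>x\<in>block_pairs \<alpha>. \<Sum>t<card (pair_monomials \<alpha> n d x). (r x t)\<^sup>2)"
    by (rule supported_sos_normal_form[OF finite_block_pairs fin p]) (rule that)
  \<comment> \<open>The coefficients of \<open>r (i, j) t\<close>, in the order in which the
    monomials stand in \<open>m\<^sub>i\<^sub>j(x)\<close>.\<close>
  define f where "f i j t = vec (\<alpha> ! i + \<alpha> ! j)
      (\<lambda>s. Poly_Mapping.lookup (r (i, j) t) (monomial_list n d ! pair_index \<alpha> (i, j) s))" for i j t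
  have "map_vec const_poly (f i j t) \<bullet> block_monomial_vec \<alpha> n d i j = r (i, j) t"
    if ij: "(i, j) \<in> block_pairs \<alpha>" and t: "t < \<alpha> ! i + \<alpha> ! j" for i j t
  proof -
    have "map_vec const_poly (f i j t) \<bullet> block_monomial_vec \<alpha> n d i j =
        (\<Sum>s<\<alpha> ! i + \<alpha> ! j. (\<lambda>m. Poly_Mapping.single m (Poly_Mapping.lookup (r (i, j) t) m))
          (monomial_list n d ! pair_index \<alpha> (i, j) s))"
      by (subst scalar_prod_block_monomial_vec[OF \<alpha> ij]) (simp_all add: f_def)
    also have "\<dots> = (\<Sum>m\<in>pair_monomials \<alpha> n d (i, j).
        Poly_Mapping.single m (Poly_Mapping.lookup (r (i, j) t) m))"
      by (rule sum.reindex_bij_betw[OF bij_betw_pair_monomials[OF \<alpha> ij]])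
    also have "\<dots> = r (i, j) t"
      using r[OF ij] t card[OF ij] fin by (intro poly_eq_sum_single[symmetric]) auto
    finally show ?thesis .
  qed
  then have "p = (\<Sum>(i, j)\<in>block_pairs \<alpha>. \<Sum>t<\<alpha> ! i + \<alpha> ! j.
      (map_vec const_poly (f i j t) \<bullet> block_monomial_vec \<alpha> n d i j)\<^sup>2)"
    unfolding p_r by (intro sum.cong refl) (auto simp: card)
  moreover have "\<forall>i j t. i < j \<and> j < length \<alpha> \<and> t < \<alpha> ! i + \<alpha> ! j \<longrightarrow>
      f i j t \<in> carrier_vec (\<alpha> ! i + \<alpha> ! j)"
    by (simp add: f_def)
  ultimately show "p \<in> block_SDSOS \<alpha> n d"
    unfolding block_SDSOS_def block_pairs_def by (intro CollectI exI[of _ f] conjI)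
qed

section \<open>Comparison of partitions\<close>

text \<open>Two blocks of \<alpha> meet at most two of the blocks of \<beta> chosen to contain them,
  so each pair of the one lies inside a pair of the other.\<close>

lemma block_SDSOS_mono:
  assumes \<alpha>: "sum_list \<alpha> = (n + d) choose d" and \<beta>: "sum_list \<beta> = (n + d) choose d"
    and len: "2 \<le> length \<beta>"
    and coarser: "\<And>i. i < length \<alpha> \<Longrightarrow> \<exists>i'<length \<beta>. block_indices \<alpha> i \<subseteq> block_indices \<beta> i'"
  shows "block_SDSOS \<alpha> n d \<subseteq> block_SDSOS \<beta> n d"
  unfolding block_SDSOS_eq_supported_sos[OF \<alpha>] block_SDSOS_eq_supported_sos[OF \<beta>]
proof (rule supported_sos_mono)
  fix S assume "S \<in> pair_monomials \<alpha> n d ` block_pairs \<alpha>"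
  then obtain i j where ij: "i < j" "j < length \<alpha>" and S: "S = pair_monomials \<alpha> n d (i, j)"
    by (auto simp: block_pairs_def)
  obtain i' j' where i': "i' < length \<beta>" "block_indices \<alpha> i \<subseteq> block_indices \<beta> i'"
    and j': "j' < length \<beta>" "block_indices \<alpha> j \<subseteq> block_indices \<beta> j'"
    using coarser[of i] coarser[of j] ij by auto
  obtain a b where ab: "a < b" "b < length \<beta>" "{i', j'} \<subseteq> {a, b}"
  proof (cases i' j' rule: linorder_cases)
    \<comment> \<open>Any other block of \<beta> completes the pair: block \<open>0\<close>, or
      block \<open>1\<close> when \<open>i' = 0\<close>. It exists because \<beta> has at least two
      blocks.\<close>
    case equal
    then show ?thesis
      using that[of 0 i'] that[of i' 1] i' len by (cases "i' = 0") auto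
  qed (use that[of i' j'] that[of j' i'] i' j' in auto)
  then have "block_indices \<alpha> i \<union> block_indices \<alpha> j \<subseteq> block_indices \<beta> a \<union> block_indices \<beta> b"
    using i' j' by auto
  then have "S \<subseteq> pair_monomials \<beta> n d (a, b)"
    unfolding S pair_monomials_def by auto
  then show "\<exists>T\<in>pair_monomials \<beta> n d ` block_pairs \<beta>. S \<subseteq> T"
    using ab by (auto simp: block_pairs_def)
qed

lemma block_indices_replicate: "i < N \<Longrightarrow> block_indices (replicate N 1) i = {i}"
  by (auto simp: block_indices_def sum_list_replicate)

text \<open>Adding up the defining equations concatenates the index intervals. Hence the block
  boundaries of \<open>b\<close> are among those of \<open>a\<close>.\<close>

lemma subpartition_sum_take:
  assumes m: "m 0 = (0 :: nat)" "m (length b) = length a" "\<forall>i<length b. m i < m (Suc i)"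
    "\<forall>i<length b. b ! i = (\<Sum>j = m i..<m (Suc i). a ! j)"
    and "i \<le> length b"
  shows "sum_list (take (m i) a) = sum_list (take i (b :: nat list))"
proof -
  \<comment> \<open>The breakpoints increase up to \<open>length a\<close>, so
    \<open>take (m i) a\<close> really has \<open>m i\<close> entries.\<close>
  have le: "i \<le> length b \<Longrightarrow> m i \<le> length a" for i
  proof -
    assume "i \<le> length b"
    then have "m i \<le> m (length b)"
      using m(3) by (induction rule: inc_induct) (auto intro: order_trans less_imp_le)
    then show ?thesis using m(2) by simp
  qed
  have "i \<le> length b \<Longrightarrow> sum_list (take i b) = (\<Sum>j = 0..<m i. a ! j)" for i
  proof (induction i)
    case (Suc i)
    then have "m i \<le> m (Suc i)" using m(3) by (simp add: less_imp_le)
    then show ?case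
      using Suc m(4) sum.atLeastLessThan_concat[of 0 "m i" "m (Suc i)" "(!) a"]
      by (simp add: sum_list_take_Suc)
  qed (simp add: m(1))
  then show ?thesis
    using assms(5) le[of i] by (simp add: sum_list_sum_nth min_absorb2)
qed

text \<open>The breakpoints bracket \<open>j\<close> between some \<open>m i\<close> and
  \<open>m (Suc i)\<close>, where the partial sums of \<open>a\<close> equal those of
  \<open>b\<close> at \<open>i\<close> and \<open>Suc i\<close>.\<close>

lemma subpartition_block_indices:
  assumes "a \<sqsubseteq>\<^sub>p b" "j < length a"
  shows "\<exists>i<length b. block_indices a j \<subseteq> block_indices b i"
proof -
  obtain m where m: "m 0 = (0 :: nat)" "m (length b) = length a" "\<forall>i<length b. m i < m (Suc i)"
    "\<forall>i<length b. b ! i = (\<Sum>j = m i..<m (Suc i). a ! j)"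
    using assms(1) unfolding subpartition_def by blast
  obtain i where i: "i < length b" "m i \<le> j" "j < m (Suc i)"
    using ex_step_interval[of m j "length b"] assms(2) m(1,2) by auto
  have "block_indices a j \<subseteq> block_indices b i"
    using sum_list_take_mono[OF i(2), of a] sum_list_take_mono[of "Suc j" "m (Suc i)" a] i
      subpartition_sum_take[OF m, of i] subpartition_sum_take[OF m, of "Suc i"]
    by (auto simp: block_indices_def)
  then show ?thesis using i by blast
qed

lemma pair_monomials_subset:
  assumes "sum_list \<alpha> = (n + d) choose d"
  shows "pair_monomials \<alpha> n d x \<subseteq> set (monomial_list n d)"
proof -
  have "\<And>r i. r \<in> block_indices \<alpha> i \<Longrightarrow> r < length (monomial_list n d)"
    using block_indices_subset[of \<alpha>] assms by (auto simp: length_monomial_list)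
  then show ?thesis by (auto simp: pair_monomials_def split: prod.split)
qed

lemma pair_monomials_two_blocks:
  assumes "N1 + N2 = (n + d) choose d"
  shows "pair_monomials [N1, N2] n d (0, 1) = set (monomial_list n d)"
proof -
  have "block_indices [N1, N2] 0 \<union> block_indices [N1, N2] 1 = {..<length (monomial_list n d)}"
    using assms by (auto simp: block_indices_def length_monomial_list)
  moreover have "(!) (monomial_list n d) ` {..<length (monomial_list n d)} = set (monomial_list n d)"
    by (auto simp: set_conv_nth)
  ultimately show ?thesis by (simp add: pair_monomials_def del: One_nat_def)
qed

section \<open>Scaled diagonally dominant matrices\<close>

text \<open>The identity \<open>v^T V V^T v = |V^T v|^2\<close> over polynomials: each column of
  \<open>V\<close> contributes one square.\<close>

lemma quadratic_form_mult_transpose: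
  fixes V :: "real mat"
  assumes "dim_row V = dim_vec v"
  shows "v \<bullet> (map_mat const_poly (V * V\<^sup>T) *\<^sub>v v) =
     (\<Sum>c<dim_col V. (\<Sum>r<dim_vec v. const_poly (V $$ (r, c)) * v $ r)\<^sup>2)"
proof -
  let ?N = "dim_vec v" and ?M = "dim_col V" and ?V = "\<lambda>r c. const_poly (V $$ (r, c))"
  have "v \<bullet> (map_mat const_poly (V * V\<^sup>T) *\<^sub>v v) =
      (\<Sum>r<?N. v $ r * (\<Sum>s<?N. (\<Sum>c<?M. ?V r c * ?V s c) * v $ s))"
    using assms
    by (simp add: scalar_prod_def atLeast0LessThan const_poly_sum const_poly_mult)
  also have "\<dots> = (\<Sum>r<?N. \<Sum>s<?N. \<Sum>c<?M. (?V r c * v $ r) * (?V s c * v $ s))"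
    by (simp add: sum_distrib_left sum_distrib_right mult_ac)
  also have "\<dots> = (\<Sum>r<?N. \<Sum>c<?M. \<Sum>s<?N. (?V r c * v $ r) * (?V s c * v $ s))"
    by (intro sum.cong refl sum.swap)
  also have "\<dots> = (\<Sum>c<?M. \<Sum>r<?N. \<Sum>s<?N. (?V r c * v $ r) * (?V s c * v $ s))"
    by (rule sum.swap)
  finally show ?thesis by (simp add: power2_eq_square sum_product)
qed

lemma pair_monomials_singletons:
  assumes "(i, j) \<in> block_pairs (replicate N 1)"
  shows "pair_monomials (replicate N 1) n d (i, j) = {monomial_list n d ! i, monomial_list n d ! j}"
  using assms by (auto simp: pair_monomials_def block_pairs_def block_indices_replicate simp del: One_nat_def)

text \<open>Sets with fewer than two elements are padded, for which \<open>2 \<le> N\<close> leaves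
  room.\<close>

lemma subset_pair:
  assumes "R \<subseteq> {..<N :: nat}" "card R \<le> 2" "2 \<le> N"
  obtains i j where "i < j" "j < N" "R \<subseteq> {i, j}"
proof -
  obtain T where T: "R \<subseteq> T" "T \<subseteq> {..<N}" "card T = 2"
    using exists_subset_between[of R 2 "{..<N}"] assms by auto
  then obtain x y where "T = {x, y}" "x \<noteq> y" by (auto simp: card_2_iff)
  then show ?thesis
    using T that[of x y] that[of y x] by (cases x y rule: linorder_cases) auto
qed

text \<open>A column of \<open>V\<close> with at most two nonzero entries is the coefficient vector
  of a polynomial with at most two monomials, and the number of columns is as free as the number of
  squares.\<close>

lemma SDSOS_eq_block_SDSOS:
  assumes N: "N = (n + d) choose d" "2 \<le> N"
  shows "SDSOS n d = block_SDSOS (replicate N 1) n d"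
proof -
  let ?ms = "monomial_list n d" and ?I = "block_pairs (replicate N 1)"
  have len: "length ?ms = N" by (simp add: N length_monomial_list)
  have sum: "sum_list (replicate N 1) = (n + d) choose d" by (simp add: N sum_list_replicate)
  have form: "monomial_vec n d \<bullet> (map_mat const_poly (V * V\<^sup>T) *\<^sub>v monomial_vec n d) =
      (\<Sum>c<dim_col V. (\<Sum>r<N. Poly_Mapping.single (?ms ! r) (V $$ (r, c)))\<^sup>2)"
    if "dim_row V = N" for V
    using that quadratic_form_mult_transpose[of V "monomial_vec n d"] N
    by (simp add: dim_monomial_vec monomial_vec_index const_poly_mult_single)
  show ?thesis
    unfolding block_SDSOS_eq_supported_sos[OF sum]
  proof (intro subset_antisym subsetI)
    fix p assume "p \<in> SDSOS n d"
    then obtain V where V: "dim_row V = N" "\<And>c. c < dim_col V \<Longrightarrow> card {r. r < N \<and> V $$ (r, c) \<noteq> 0} \<le> 2"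
      and p: "p = monomial_vec n d \<bullet> (map_mat const_poly (V * V\<^sup>T) *\<^sub>v monomial_vec n d)"
      unfolding SDSOS_def FW2_def N by blast
    have "(\<Sum>r<N. Poly_Mapping.single (?ms ! r) (V $$ (r, c)))\<^sup>2
        \<in> supported_sos (pair_monomials (replicate N 1) n d ` ?I)"
      if "c < dim_col V" for c
    proof -
      obtain i j where ij: "i < j" "j < N" "{r. r < N \<and> V $$ (r, c) \<noteq> 0} \<subseteq> {i, j}"
        using subset_pair[of "{r. r < N \<and> V $$ (r, c) \<noteq> 0}" N] V(2)[of c] \<open>c < dim_col V\<close> N(2)
        by auto
      then have ij': "(i, j) \<in> ?I" by (simp add: block_pairs_def)
      show ?thesis
      proof (rule supported_sos_square)
        show "pair_monomials (replicate N 1) n d (i, j) \<in> pair_monomials (replicate N 1) n d ` ?I"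
          using ij' by blast
        show "Poly_Mapping.keys (\<Sum>r<N. Poly_Mapping.single (?ms ! r) (V $$ (r, c)))
            \<subseteq> pair_monomials (replicate N 1) n d (i, j)"
          unfolding pair_monomials_singletons[OF ij']
          by (rule keys_sum_subset) (use ij(3) in auto)
      qed
    qed
    then show "p \<in> supported_sos (pair_monomials (replicate N 1) n d ` ?I)"
      unfolding p form[OF V(1)] by (intro supported_sos_sum) auto
  next
    fix p assume "p \<in> supported_sos (pair_monomials (replicate N 1) n d ` ?I)"
    then obtain qs where p: "p = (\<Sum>q\<leftarrow>qs. q\<^sup>2)"
      and qs: "\<And>q. q \<in> set qs \<Longrightarrow> \<exists>x\<in>?I. Poly_Mapping.keys q \<subseteq> pair_monomials (replicate N 1) n d x"
      unfolding supported_sos_def by blast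
    \<comment> \<open>One column per square, holding the coefficients of that polynomial along the
      monomial list.\<close>
    define V where "V = mat N (length qs) (\<lambda>(r, c). Poly_Mapping.lookup (qs ! c) (?ms ! r))"
    have V: "dim_row V = N" "dim_col V = length qs" by (simp_all add: V_def)
    have bij: "bij_betw ((!) ?ms) {..<N} (set ?ms)"
      using bij_betw_nth[OF distinct_monomial_list] len by blast
    have "card {r. r < N \<and> V $$ (r, c) \<noteq> 0} \<le> 2" if c: "c < length qs" for c
    proof -
      obtain i j where ij: "(i, j) \<in> ?I" "Poly_Mapping.keys (qs ! c) \<subseteq> {?ms ! i, ?ms ! j}"
        using qs[of "qs ! c"] c pair_monomials_singletons by fastforce
      have "{r. r < N \<and> V $$ (r, c) \<noteq> 0} \<subseteq> {i, j}"
      proof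
        fix r assume "r \<in> {r. r < N \<and> V $$ (r, c) \<noteq> 0}"
        then have "r < N" "?ms ! r \<in> Poly_Mapping.keys (qs ! c)"
          using c by (auto simp: V_def in_keys_iff)
        then show "r \<in> {i, j}"
          using ij len by (auto simp: block_pairs_def nth_eq_iff_index_eq[OF distinct_monomial_list])
      qed
      then have "card {r. r < N \<and> V $$ (r, c) \<noteq> 0} \<le> card {i, j}"
        by (intro card_mono) auto
      also have "\<dots> \<le> 2" by (simp add: card_insert_if)
      finally show ?thesis .
    qed
    then have "V * V\<^sup>T \<in> FW2 N" using V unfolding FW2_def by auto
    moreover have "p = monomial_vec n d \<bullet> (map_mat const_poly (V * V\<^sup>T) *\<^sub>v monomial_vec n d)"
    proof -
      have "(\<Sum>r<N. Poly_Mapping.single (?ms ! r) (V $$ (r, c))) = qs ! c" if c: "c < length qs" for c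
      proof -
        have "(\<Sum>r<N. Poly_Mapping.single (?ms ! r) (V $$ (r, c))) =
            (\<Sum>r<N. (\<lambda>m. Poly_Mapping.single m (Poly_Mapping.lookup (qs ! c) m)) (?ms ! r))"
          using c by (simp add: V_def)
        also have "\<dots> = (\<Sum>m\<in>set ?ms. Poly_Mapping.single m (Poly_Mapping.lookup (qs ! c) m))"
          by (rule sum.reindex_bij_betw[OF bij])
        also have "\<dots> = qs ! c"
          using qs[of "qs ! c"] c pair_monomials_subset[OF sum]
          by (intro poly_eq_sum_single[symmetric]) auto
        finally show ?thesis .
      qed
      then show ?thesis
        unfolding form[OF V(1)] p by (simp add: sum_list_sum_nth atLeast0LessThan V(2))
    qed
    ultimately show "p \<in> SDSOS n d" unfolding SDSOS_def N(1) by blast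
  qed
qed

section \<open>The chain of cones between SDSOS and SOS\<close>

theorem corollary4:
  fixes n d N N1 N2 :: nat
    and \<alpha> \<beta> :: "nat list"
  assumes "N = (n + d) choose d"
    and "is_partition N \<alpha>"
    and "is_partition N \<beta>"
    and "is_partition N [N1, N2]"
    and "\<alpha> \<sqsubseteq>\<^sub>p \<beta>"
  shows "SDSOS n d = block_SDSOS (replicate N 1) n d \<and>
         block_SDSOS (replicate N 1) n d \<subseteq> block_SDSOS \<alpha> n d \<and>
         block_SDSOS \<alpha> n d \<subseteq> block_SDSOS \<beta> n d \<and>
         block_SDSOS \<beta> n d \<subseteq> block_SDSOS [N1, N2] n d \<and>
         block_SDSOS [N1, N2] n d = SOS n d"
proof -
  have \<alpha>: "sum_list \<alpha> = (n + d) choose d" "2 \<le> length \<alpha>"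
    and \<beta>: "sum_list \<beta> = (n + d) choose d" "2 \<le> length \<beta>"
    and \<gamma>: "N1 + N2 = (n + d) choose d" "0 < N1" "0 < N2"
    using assms(1-4) by (auto simp: is_partition_def)
  have ones: "sum_list (replicate N 1) = (n + d) choose d"
    using assms(1) by (simp add: sum_list_replicate)
  have "SDSOS n d = block_SDSOS (replicate N 1) n d"
    using \<gamma> assms(1) by (intro SDSOS_eq_block_SDSOS) auto
  \<comment> \<open>Checked directly, since \<open>\<sqsubseteq>\<^sub>p\<close> demands strictly
    more blocks and so fails when \<alpha> is itself \<open>replicate N 1\<close>: a singleton block
    lies in whichever block of \<alpha> contains its position.\<close>
  moreover have "block_SDSOS (replicate N 1) n d \<subseteq> block_SDSOS \<alpha> n d"
  proof (rule block_SDSOS_mono[OF ones \<alpha>])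
    fix i assume "i < length (replicate N (1 :: nat))"
    then show "\<exists>i'<length \<alpha>. block_indices (replicate N 1) i \<subseteq> block_indices \<alpha> i'"
      using ex_block_index[of i \<alpha>] \<alpha>(1) assms(1) block_indices_replicate[of i N] by auto
  qed
  moreover have "block_SDSOS \<alpha> n d \<subseteq> block_SDSOS \<beta> n d"
    using subpartition_block_indices[OF assms(5)] by (rule block_SDSOS_mono[OF \<alpha>(1) \<beta>])
  moreover have \<gamma>_SOS: "block_SDSOS [N1, N2] n d = SOS n d"
  proof -
    \<comment> \<open>Two blocks form a single pair, and that pair takes in all monomials.\<close>
    have "block_pairs [N1, N2] = {(0, 1)}" by (auto simp: block_pairs_def)
    then show ?thesis
      using block_SDSOS_eq_supported_sos[of "[N1, N2]" n d] pair_monomials_two_blocks[OF \<gamma>(1)] \<gamma>(1)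
      by (simp add: SOS_eq_supported_sos)
  qed
  \<comment> \<open>\<open>[N1, N2]\<close> need not be coarser than \<beta>, so blocks cannot be
    compared; instead the single support of \<open>SOS\<close> contains every pair.\<close>
  moreover have "block_SDSOS \<beta> n d \<subseteq> block_SDSOS [N1, N2] n d"
    unfolding \<gamma>_SOS SOS_eq_supported_sos block_SDSOS_eq_supported_sos[OF \<beta>(1)]
    by (rule supported_sos_mono) (use pair_monomials_subset[OF \<beta>(1)] in blast)
  ultimately show ?thesis by blast
qed

end
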